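(* There exists a strongly rigid anticompact countable Hausdorff topological space.
   Context: A topological space $X$ is strongly rigid if every continuous map $f:X\to X$ that is not the identity map of $X$ is constant. A topological space is anticompact if every compact subspace of it is finite. *)

theory Defs
  imports "HOL-Analysis.Analysis"
begin

text \<open>
  Equality of maps is only required on \<^term>\<open>topspace X\<close>, since
  \<^term>\<open>continuous_map X X f\<close> says nothing about \<^term>\<open>f\<close> elsewhere.
\<close>

definition strongly_rigid :: "'a topology \<Rightarrow> bool" where
  "strongly_rigid X \<longleftrightarrow>
     (\<forall>f. continuous_map X X f \<longrightarrow> \<not> (\<forall>x\<in>topspace X. f x = x) \<longrightarrow>
          (\<exists>c\<in>topspace X. \<forall>x\<in>topspace X. f x = c))"

definition anticompact :: "'a topology \<Rightarrow> bool" where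
  "anticompact X \<longleftrightarrow> (\<forall>K. compactin X K \<longrightarrow> finite K)"

end

theory Submission
  imports Defs "HOL-Number_Theory.Cong"
begin

text \<open>
  Call a space Brown if the closures of any two nonempty open sets meet. A continuous map
  from a Brown space to a Hausdorff space that is constant on one nonempty open set is constant
  everywhere; hence a non-constant one takes infinitely many values on every nonempty open set.
  The Golomb topology on the positive integers is Hausdorff, second countable and Brown. The
  strongly rigid space is obtained from it, or from any other such topology \<open>T\<close>
  on an infinite set of naturals, by declaring many sets closed.

  Inside the sets of a countable base choose disjoint finite blocks, so that every nonempty open
  set contains infinitely many of them, and so that each block is enormous compared with all the
  points before it. A set is small if it meets the \<open>l\<close>-th block in at most a constant times
  as many points as there are before that block. Small sets form an ideal containing no nonempty
  open set, and the finer topology has as its base the differences of an open set and a small set.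
  Removing small sets does not shrink the closure of an open set, so the finer space is still
  Brown; it is anticompact because every infinite set contains an infinite small set, all of whose
  subsets are closed.

  Now let \<open>f\<close> be continuous and non-constant for the finer topology, with
  \<open>f x \<noteq> x\<close>. Some neighbourhood \<open>U\<close> of \<open>x\<close> has all of its points outside a small set sent
  out of \<open>U\<close>, and on smaller neighbourhoods \<open>f\<close> still has values outside any given finite set. So there are blocks as close to \<open>x\<close> as desired, most of
  whose points are sent neither into the same block nor into a prescribed finite set containing
  \<open>f x\<close>. By the pigeonhole principle one of two things happens in such a block: many points are
  sent beyond it, where the following blocks are so large that the image of the whole block
  becomes negligible, or many points are sent to one and the same value. Either way a small set of
  values has a preimage in the block that is not negligible. The union \<open>E\<close> of these small sets, for
  blocks approaching \<open>x\<close>, can be kept small, so \<open>E\<close> is closed and misses \<open>f x\<close>, while its preimage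
  accumulates at \<open>x\<close>: a contradiction. The dichotomy is
  \<open>value_set_with_large_preimage\<close>, and the approach to \<open>x\<close> is carried out in
  \<open>strongly_rigid_refined\<close>.
\<close>

section \<open>Brown spaces\<close>

definition brown_space :: "'a topology \<Rightarrow> bool" where
  "brown_space X \<longleftrightarrow>
     (\<forall>U W. openin X U \<longrightarrow> U \<noteq> {} \<longrightarrow> openin X W \<longrightarrow> W \<noteq> {} \<longrightarrow>
        X closure_of U \<inter> X closure_of W \<noteq> {})"

text \<open>
  If another value \<open>f d\<close> existed, the preimage of a neighbourhood of \<open>f d\<close> whose closure misses
  \<open>c\<close> would be open; a common closure point of it and \<open>U\<close> would have to be sent to \<open>c\<close>, yet every
  neighbourhood of that point would contain points sent close to \<open>f d\<close>.
\<close>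

lemma brown_space_constant:
  assumes brown: "brown_space X" and haus: "Hausdorff_space Y" and f: "continuous_map X Y f"
    and U: "openin X U" "U \<noteq> {}" "\<And>x. x \<in> U \<Longrightarrow> f x = c" and d: "d \<in> topspace X"
  shows "f d = c"
proof (rule ccontr)
  assume neq: "f d \<noteq> c"
  have "U \<subseteq> topspace X" using U openin_subset by blast
  then have "c \<in> topspace Y" "f d \<in> topspace Y"
    using U(2,3) d f continuous_map_image_subset_topspace by fastforce+
  then obtain W1 W2 where W: "openin Y W1" "openin Y W2" "c \<in> W1" "f d \<in> W2" "disjnt W1 W2"
    using haus neq unfolding Hausdorff_space_def by metis
  have pre: "openin X {x \<in> topspace X. f x \<in> W}" if "openin Y W" for W
    using f that by (rule openin_continuous_map_preimage)
  have "{x \<in> topspace X. f x \<in> W2} \<noteq> {}" using d W by auto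
  then obtain w where w: "w \<in> X closure_of U" "w \<in> X closure_of {x \<in> topspace X. f x \<in> W2}"
    using brown U pre[OF W(2)] unfolding brown_space_def by blast
  have wX: "w \<in> topspace X" using w(1) by (simp add: in_closure_of)
  have "f w = c"
  proof -
    have "closedin X {x \<in> topspace X. f x \<in> {c}}"
      using f closedin_Hausdorff_singleton[OF haus \<open>c \<in> topspace Y\<close>]
      by (rule closedin_continuous_map_preimage)
    moreover have "U \<subseteq> {x \<in> topspace X. f x \<in> {c}}"
      using U \<open>U \<subseteq> topspace X\<close> by auto
    ultimately show ?thesis using w(1) closure_of_minimal by blast
  qed
  then have w1: "w \<in> {x \<in> topspace X. f x \<in> W1}" using W wX by simp
  have "\<exists>z. z \<in> {x \<in> topspace X. f x \<in> W2} \<and> z \<in> S" if "w \<in> S" "openin X S" for S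
    using w(2) that unfolding in_closure_of by simp
  from this[OF w1 pre[OF W(1)]]
  obtain z where "f z \<in> W1" "f z \<in> W2" by blast
  then show False using W(5) by (auto simp: disjnt_iff)
qed

text \<open>
  With finitely many values on \<open>U\<close>, the points of \<open>U\<close> that share one value form an open set, to
  which the previous lemma applies.
\<close>

lemma brown_space_infinite_image:
  assumes brown: "brown_space X" and haus: "Hausdorff_space Y" and f: "continuous_map X Y f"
    and nonconst: "\<nexists>c. \<forall>x\<in>topspace X. f x = c"
    and U: "openin X U" "U \<noteq> {}"
  shows "infinite (f ` U)"
proof
  assume fin: "finite (f ` U)"
  obtain u where u: "u \<in> U" using U by blast
  have UX: "U \<subseteq> topspace X" using U openin_subset by blast
  have "f ` U - {f u} \<subseteq> topspace Y"
    using f UX continuous_map_image_subset_topspace by blast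
  then have "closedin Y (f ` U - {f u})"
    using fin haus by (simp add: closedin_Hausdorff_finite)
  then have "openin Y (topspace Y - (f ` U - {f u}))"
    by blast
  then have "openin X {x \<in> topspace X. f x \<in> topspace Y - (f ` U - {f u})}"
    using f by (rule openin_continuous_map_preimage[rotated])
  then have o: "openin X (U \<inter> {x \<in> topspace X. f x \<in> topspace Y - (f ` U - {f u})})"
    using U by blast
  have "f d = f u" if "d \<in> topspace X" for d
  proof (rule brown_space_constant[OF brown haus f o _ _ that])
    have "f u \<in> topspace Y"
      using u UX f continuous_map_image_subset_topspace by blast
    then show "U \<inter> {x \<in> topspace X. f x \<in> topspace Y - (f ` U - {f u})} \<noteq> {}"
      using u UX by auto
  qed auto
  then show False using nonconst by blast
qed

text \<open>
  A finite open set would be clopen, and so would its complement.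
\<close>

lemma brown_space_open_infinite:
  assumes brown: "brown_space X" and haus: "Hausdorff_space X" and inf: "infinite (topspace X)"
    and U: "openin X U" "U \<noteq> {}"
  shows "infinite U"
proof
  assume fin: "finite U"
  have UX: "U \<subseteq> topspace X" using U openin_subset by blast
  have cl: "closedin X U" using fin UX haus by (simp add: closedin_Hausdorff_finite)
  have op: "openin X (topspace X - U)" "closedin X (topspace X - U)"
    using cl U by blast+
  have "topspace X - U \<noteq> {}" using fin inf by (metis Diff_eq_empty_iff finite_subset)
  then have "X closure_of U \<inter> X closure_of (topspace X - U) \<noteq> {}"
    using brown U op unfolding brown_space_def by blast
  then show False using cl op by (simp add: closure_of_closedin)
qed

section \<open>Blocks and small sets\<close>

lemma fat_fibre:
  assumes "finite A" "f ` Q \<subseteq> A" "card A * k < card Q"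
  shows "\<exists>v\<in>A. k < card {z \<in> Q. f z = v}"
proof (rule ccontr)
  assume "\<not> ?thesis"
  then have *: "\<And>v. v \<in> A \<Longrightarrow> card {z \<in> Q. f z = v} \<le> k" by (meson not_le)
  have "Q = (\<Union>v\<in>A. {z \<in> Q. f z = v})" using assms by auto
  then have "card Q \<le> (\<Sum>v\<in>A. card {z \<in> Q. f z = v})"
    using card_UN_le[OF assms(1), of "\<lambda>v. {z \<in> Q. f z = v}"] by simp
  also have "\<dots> \<le> card A * k" using sum_bounded_above[OF *] by simp
  finally show False using assms(3) by simp
qed

lemma infinite_nat_segment:
  fixes S :: "nat set"
  assumes "infinite S"
  shows "\<exists>n>a. k < card (S \<inter> {a..<n})"
proof -
  have "infinite (S - {..<a})" using assms by simp
  then obtain F where F: "finite F" "card F = Suc k" "F \<subseteq> S - {..<a}"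
    using infinite_arbitrarily_large by blast
  obtain n where n: "\<forall>x\<in>F. x < n" using F(1) finite_nat_bounded by (metis lessThan_iff subsetD)
  have "F \<subseteq> S \<inter> {a..<max n (Suc a)}" using F n by fastforce
  then have "Suc k \<le> card (S \<inter> {a..<max n (Suc a)})"
    using F(2) by (metis card_mono finite_Int finite_atLeastLessThan)
  then show ?thesis by (intro exI[of _ "max n (Suc a)"]) auto
qed

text \<open>
  A sequence enumerating a base, rather than the base itself, lets the blocks be numbered by
  naturals; \<open>V\<close> need not be injective.
\<close>

locale brown_base =
  fixes T :: "nat topology" and V :: "nat \<Rightarrow> nat set"
  assumes hausdorff: "Hausdorff_space T"
    and brown: "brown_space T"
    and infinite_topspace: "infinite (topspace T)"
    and V_open: "openin T (V m)"
    and V_nonempty: "V m \<noteq> {}"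
    and V_base: "openin T U \<Longrightarrow> x \<in> U \<Longrightarrow> \<exists>m. x \<in> V m \<and> V m \<subseteq> U"
begin

text \<open>
  The \<open>l\<close>-th block lies between two consecutive cutoffs and inside the base set coded by the first
  component of \<open>l\<close>, so each base set receives infinitely many blocks. The second cutoff is pushed
  out until the block has more than \<open>2 l\<close> times the square of the first: one factor
  \<open>cutoff l\<close> is spent on the pigeonhole principle over the values below the block,
  the other on exceeding the bound that defines small sets, and the factor \<open>2 l\<close> on absorbing the
  constants in that bound.
\<close>

primrec cutoff :: "nat \<Rightarrow> nat" where
  "cutoff 0 = 1"
| "cutoff (Suc l) = (SOME n. cutoff l < n \<and>
     2 * l * (cutoff l * cutoff l) < card (V (fst (prod_decode l)) \<inter> {cutoff l..<n}))"

declare cutoff.simps(2) [simp del]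

definition block :: "nat \<Rightarrow> nat set" where
  "block l = V (fst (prod_decode l)) \<inter> {cutoff l..<cutoff (Suc l)}"

lemma V_infinite: "infinite (V m)"
  using brown_space_open_infinite[OF brown hausdorff infinite_topspace V_open V_nonempty] .

lemma cutoff_Suc_spec: "cutoff l < cutoff (Suc l) \<and> 2 * l * (cutoff l * cutoff l) < card (block l)"
  using someI_ex[OF infinite_nat_segment[OF V_infinite, of "cutoff l" "2 * l * (cutoff l * cutoff l)"
      "fst (prod_decode l)"]]
  unfolding block_def cutoff.simps by blast

lemma cutoff_strict_mono: "strict_mono cutoff"
  using cutoff_Suc_spec by (simp add: strict_mono_Suc_iff)

lemma cutoff_mono: "i \<le> j \<Longrightarrow> cutoff i \<le> cutoff j"
  using cutoff_strict_mono by (simp add: strict_mono_less_eq)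

lemma cutoff_ge: "l \<le> cutoff l"
  using cutoff_strict_mono by (rule strict_mono_imp_increasing)

lemma cutoff_pos: "1 \<le> cutoff l"
  using cutoff_mono[of 0 l] by simp

lemma block_card: "2 * l * (cutoff l * cutoff l) < card (block l)"
  using cutoff_Suc_spec by blast

lemma block_finite: "finite (block l)"
  by (simp add: block_def)

lemma block_bounds: "z \<in> block l \<Longrightarrow> cutoff l \<le> z" "z \<in> block l \<Longrightarrow> z < cutoff (Suc l)"
  by (simp_all add: block_def)

lemma block_in_V: "\<exists>l\<ge>k. block l \<subseteq> V m"
  by (rule exI[of _ "prod_encode (m, k)"]) (auto simp: block_def le_prod_encode_2)

text \<open>
  Since the cutoff bounds the number of points of all earlier blocks, the image of those blocks
  under any map is small within the current one.
\<close>

definition small :: "nat set \<Rightarrow> bool" where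
  "small B \<longleftrightarrow> (\<exists>C. \<forall>l. card (B \<inter> block l) \<le> C * cutoff l)"

lemma small_subset: "small B \<Longrightarrow> A \<subseteq> B \<Longrightarrow> small A"
  unfolding small_def
  by (meson Int_mono block_finite card_mono finite_Int order_refl order_trans)

lemma small_Un:
  assumes "small A" "small B"
  shows "small (A \<union> B)"
proof -
  obtain C D where C: "\<And>l. card (A \<inter> block l) \<le> C * cutoff l" and D: "\<And>l. card (B \<inter> block l) \<le> D * cutoff l"
    using assms unfolding small_def by blast
  have "card ((A \<union> B) \<inter> block l) \<le> (C + D) * cutoff l" for l
    using card_Un_le[of "A \<inter> block l" "B \<inter> block l"] C[of l] D[of l]
    by (simp add: Int_Un_distrib2 add_mult_distrib)
  then show ?thesis unfolding small_def by blast
qed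

lemma small_if_card_le:
  "(\<And>l. card (B \<inter> block l) \<le> C * cutoff l) \<Longrightarrow> small B"
  unfolding small_def by blast

lemma small_finite:
  assumes "finite B" shows "small B"
proof (rule small_if_card_le)
  fix l
  have "card (B \<inter> block l) \<le> card B * 1" using assms by (simp add: card_mono)
  also have "\<dots> \<le> card B * cutoff l" using cutoff_pos by (rule mult_le_mono2)
  finally show "card (B \<inter> block l) \<le> card B * cutoff l" .
qed

text \<open>
  A term of the sequence that lies in a block must have an index less than that of the block, and
  the index of a block is at most its cutoff.
\<close>

lemma small_escaping:
  assumes e: "\<And>n. cutoff (Suc n) \<le> e n" and B: "B \<subseteq> range e"
  shows "small B"
proof (rule small_if_card_le)
  fix l
  have "n < l" if "e n \<in> block l" for n
  proof (rule ccontr)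
    assume "\<not> n < l"
    then have "cutoff (Suc l) \<le> cutoff (Suc n)" by (intro cutoff_mono) simp
    then show False using e[of n] block_bounds(2)[OF that] by simp
  qed
  then have "B \<inter> block l \<subseteq> e ` {..<l}" using B by auto
  then have "card (B \<inter> block l) \<le> card (e ` {..<l})" by (simp add: card_mono)
  also have "\<dots> \<le> l" using card_image_le[of "{..<l}" e] by simp
  finally show "card (B \<inter> block l) \<le> 1 * cutoff l" using cutoff_ge[of l] by simp
qed

text \<open>
  An open set contains whole blocks of arbitrarily large index, whose size outgrows every multiple
  of their cutoff.
\<close>

lemma open_not_small:
  assumes U: "openin T U" "U \<noteq> {}"
  shows "\<not> small U"
proof
  assume "small U"
  then obtain C where C: "\<And>l. card (U \<inter> block l) \<le> C * cutoff l" unfolding small_def by blast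
  obtain m where "V m \<subseteq> U" using U V_base by blast
  then obtain l where l: "l \<ge> C" "block l \<subseteq> U" using block_in_V by blast
  have "C * cutoff l \<le> l * (cutoff l * cutoff l)" using l(1) cutoff_pos[of l] by (intro mult_le_mono) auto
  moreover have "card (block l) \<le> C * cutoff l" using C[of l] l(2) by (simp add: Int_absorb1)
  ultimately show False using block_card[of l] by linarith
qed

section \<open>The topology in which small sets are closed\<close>

definition refined :: "nat topology" where
  "refined = topology (\<lambda>W. W \<subseteq> topspace T \<and>
     (\<forall>x\<in>W. \<exists>U B. openin T U \<and> small B \<and> x \<in> U - B \<and> U - B \<subseteq> W))"

lemma openin_refined:
  "openin refined W \<longleftrightarrow> W \<subseteq> topspace T \<and>
     (\<forall>x\<in>W. \<exists>U B. openin T U \<and> small B \<and> x \<in> U - B \<and> U - B \<subseteq> W)"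
proof -
  have "istopology (\<lambda>W. W \<subseteq> topspace T \<and>
     (\<forall>x\<in>W. \<exists>U B. openin T U \<and> small B \<and> x \<in> U - B \<and> U - B \<subseteq> W))" (is "istopology ?L")
    unfolding istopology_def
  proof (intro conjI allI impI)
    fix S S' assume S: "?L S" and S': "?L S'"
    show "S \<inter> S' \<subseteq> topspace T" using S by blast
    show "\<forall>x\<in>S \<inter> S'. \<exists>U B. openin T U \<and> small B \<and> x \<in> U - B \<and> U - B \<subseteq> S \<inter> S'"
    proof
      fix x assume x: "x \<in> S \<inter> S'"
      obtain U B where 1: "openin T U" "small B" "x \<in> U - B" "U - B \<subseteq> S" using S x by blast
      obtain U' B' where 2: "openin T U'" "small B'" "x \<in> U' - B'" "U' - B' \<subseteq> S'"
        using S' x by blast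
      show "\<exists>U B. openin T U \<and> small B \<and> x \<in> U - B \<and> U - B \<subseteq> S \<inter> S'"
        using 1 2 by (intro exI[of _ "U \<inter> U'"] exI[of _ "B \<union> B'"]) (auto simp: small_Un)
    qed
  next
    fix \<K> assume K: "\<forall>K\<in>\<K>. ?L K"
    then show "\<Union>\<K> \<subseteq> topspace T" by blast
    show "\<forall>x\<in>\<Union>\<K>. \<exists>U B. openin T U \<and> small B \<and> x \<in> U - B \<and> U - B \<subseteq> \<Union>\<K>"
    proof
      fix x assume "x \<in> \<Union>\<K>"
      then obtain K where "K \<in> \<K>" "x \<in> K" by blast
      moreover from this obtain U B where
        "openin T U" "small B" "x \<in> U - B" "U - B \<subseteq> K" using K by meson
      ultimately show "\<exists>U B. openin T U \<and> small B \<and> x \<in> U - B \<and> U - B \<subseteq> \<Union>\<K>"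
        by (meson Union_upper subset_trans)
    qed
  qed
  then show ?thesis unfolding refined_def by (simp add: topology_inverse')
qed

lemma openin_refinedE:
  assumes "openin refined W" "x \<in> W"
  obtains U B where "openin T U" "small B" "x \<in> U - B" "U - B \<subseteq> W"
  using assms unfolding openin_refined by blast

lemma openin_refined_diff:
  assumes "openin T U" "small B" shows "openin refined (U - B)"
  unfolding openin_refined using assms openin_subset[of T U] by blast

lemma openin_refined_if_openin: "openin T U \<Longrightarrow> openin refined U"
  using openin_refined_diff[of U "{}"] by (simp add: small_finite)

lemma topspace_refined: "topspace refined = topspace T"
  using openin_refined_if_openin[of "topspace T"] openin_refined[of "topspace refined"]
  by (meson openin_subset openin_topspace subset_antisym)

lemma closedin_refined_small: "small B \<Longrightarrow> B \<subseteq> topspace T \<Longrightarrow> closedin refined B"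
  unfolding closedin_def topspace_refined by (simp add: openin_refined_diff)

lemma hausdorff_refined: "Hausdorff_space refined"
  using hausdorff openin_refined_if_openin unfolding Hausdorff_space_def topspace_refined by meson

text \<open>
  Removing a small set from an open set \<open>U\<close> and passing to the finer topology does not shrink the
  closure: a basic neighbourhood \<open>G - A\<close> of a point of the old closure meets \<open>U - B\<close>, because the
  nonempty open set \<open>G \<inter> U\<close> is not covered by the small set \<open>A \<union> B\<close>.
\<close>

lemma brown_refined: "brown_space refined"
proof -
  have closure: "T closure_of U \<subseteq> refined closure_of (U - B)" if "openin T U" "small B" for U B
  proof
    fix w assume w: "w \<in> T closure_of U"
    have "\<exists>z\<in>U - B. z \<in> W" if W: "openin refined W" "w \<in> W" for W
    proof -
      obtain G A where G: "openin T G" "small A" "w \<in> G - A" "G - A \<subseteq> W"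
        using W unfolding openin_refined by blast
      have "G \<inter> U \<noteq> {}" using w G unfolding in_closure_of by blast
      moreover have "openin T (G \<inter> U)" using G \<open>openin T U\<close> by blast
      ultimately have "\<not> G \<inter> U \<subseteq> A \<union> B"
        using open_not_small small_subset small_Un[OF \<open>small A\<close> \<open>small B\<close>] by blast
      then show ?thesis using G(4) by blast
    qed
    then show "w \<in> refined closure_of (U - B)"
      using w unfolding in_closure_of topspace_refined by blast
  qed
  show ?thesis
    unfolding brown_space_def
  proof (intro allI impI)
    fix O1 O2 assume O: "openin refined O1" "O1 \<noteq> {}" "openin refined O2" "O2 \<noteq> {}"
    obtain U1 B1 where 1: "openin T U1" "small B1" "U1 \<noteq> {}" "U1 - B1 \<subseteq> O1"
      using O(1,2) unfolding openin_refined by blast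
    obtain U2 B2 where 2: "openin T U2" "small B2" "U2 \<noteq> {}" "U2 - B2 \<subseteq> O2"
      using O(3,4) unfolding openin_refined by blast
    have "T closure_of U1 \<inter> T closure_of U2 \<noteq> {}"
      using brown 1 2 unfolding brown_space_def by blast
    moreover have "T closure_of U1 \<subseteq> refined closure_of O1" "T closure_of U2 \<subseteq> refined closure_of O2"
      using closure[OF 1(1,2)] closure[OF 2(1,2)] 1(4) 2(4) closure_of_mono by (meson subset_trans)+
    ultimately show "refined closure_of O1 \<inter> refined closure_of O2 \<noteq> {}" by blast
  qed
qed

text \<open>
  A sequence in an infinite compact set that runs to infinity fast enough has a small range, so
  the range is an infinite subset that is closed and discrete.
\<close>

lemma anticompact_refined: "anticompact refined"
  unfolding anticompact_def
proof (intro allI impI, rule ccontr)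
  fix K assume K: "compactin refined K" and inf: "infinite K"
  have KT: "K \<subseteq> topspace T" using K compactin_subset_topspace topspace_refined by metis
  have "\<exists>e\<in>K. cutoff (Suc n) \<le> e" for n using inf by (meson infinite_nat_iff_unbounded_le)
  then obtain e where e: "\<And>n. e n \<in> K" "\<And>n. cutoff (Suc n) \<le> e n" by metis
  have "infinite (range e)"
  proof
    assume "finite (range e)"
    then obtain k where "\<And>n. e n < k" using finite_nat_bounded by (metis lessThan_iff rangeI subsetD)
    then have "e k < k" by blast
    then show False using e(2)[of k] cutoff_ge[of "Suc k"] by linarith
  qed
  moreover have "finite (range e)"
  proof -
    have closed: "closedin refined B" if "B \<subseteq> range e" for B
      using closedin_refined_small small_escaping[OF e(2) that] that e(1) KT by blast
    have "compactin refined (range e)"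
      using closed_compactin[OF K _ closed[OF order_refl]] e(1) by blast
    moreover have "subtopology refined (range e) = discrete_topology (range e)"
    proof -
      have sub: "range e \<subseteq> topspace refined" using e(1) KT topspace_refined by auto
      have "openin (subtopology refined (range e)) {v}" if "v \<in> range e" for v
        unfolding openin_subtopology
      proof (intro exI conjI)
        show "openin refined (topspace refined - (range e - {v}))"
          using closed[of "range e - {v}"] by blast
        show "{v} = (topspace refined - (range e - {v})) \<inter> range e" using sub that by blast
      qed
      then show ?thesis
        using sub by (metis discrete_topology_unique topspace_subtopology_subset)
    qed
    ultimately show ?thesis
      by (metis compactin_subspace compact_space_discrete_topology)
  qed
  ultimately show False by blast
qed

section \<open>Strong rigidity\<close>

text \<open>
  If few points of \<open>Q\<close> have values at or above the cutoff, then most points share the at most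
  \<open>cutoff l\<close> values below it, and one of these values has a large fibre. The two alternatives for
  \<open>E\<close> reflect two reasons for which the union of such sets over many blocks is small: values
  beyond their block are controlled by the sizes of earlier blocks, and single values can be made
  to run to infinity.
\<close>

lemma value_set_with_large_preimage:
  assumes Q: "Q \<subseteq> block l" and fQ: "f ` Q \<inter> block l = {}"
    and card: "j * cutoff l + cutoff l * (j * cutoff l) < card Q"
  shows "\<exists>E \<subseteq> f ` Q. j * cutoff l < card {z \<in> Q. f z \<in> E} \<and>
    (E \<subseteq> {cutoff l..} - block l \<or> (\<exists>v. E = {v}))"
proof (cases "j * cutoff l < card {z \<in> Q. cutoff l \<le> f z}")
  case True
  have "{z \<in> Q. f z \<in> f ` Q \<inter> {cutoff l..}} = {z \<in> Q. cutoff l \<le> f z}" by auto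
  then show ?thesis using True fQ by (intro exI[of _ "f ` Q \<inter> {cutoff l..}"]) auto
next
  case False
  have finQ: "finite Q" using Q block_finite finite_subset by blast
  have "Q = {z \<in> Q. cutoff l \<le> f z} \<union> {z \<in> Q. f z < cutoff l}" by auto
  then have "card Q \<le> card {z \<in> Q. cutoff l \<le> f z} + card {z \<in> Q. f z < cutoff l}"
    by (metis (no_types, lifting) card_Un_le)
  then have "card {..<cutoff l} * (j * cutoff l) < card {z \<in> Q. f z < cutoff l}"
    using False card by simp
  then obtain v where v: "j * cutoff l < card {z \<in> {z \<in> Q. f z < cutoff l}. f z = v}"
    using fat_fibre[of "{..<cutoff l}" f "{z \<in> Q. f z < cutoff l}" "j * cutoff l"] by blast
  then have "{z \<in> {z \<in> Q. f z < cutoff l}. f z = v} \<noteq> {}"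
    by (metis card.empty not_less_zero)
  then obtain z where z: "z \<in> Q" "f z = v" by blast
  have "{z \<in> {z \<in> Q. f z < cutoff l}. f z = v} \<subseteq> {z \<in> Q. f z \<in> {v}}" by auto
  then have "card {z \<in> {z \<in> Q. f z < cutoff l}. f z = v} \<le> card {z \<in> Q. f z \<in> {v}}"
    using finQ by (intro card_mono) simp_all
  then have "j * cutoff l < card {z \<in> Q. f z \<in> {v}}" using v by linarith
  then show ?thesis using z by (intro exI[of _ "{v}"]) auto
qed

text \<open>
  The sets \<open>D j\<close> form a neighbourhood base of \<open>x\<close>, chosen inside a neighbourhood \<open>U\<close> such that,
  apart from the small set \<open>B0\<close>, no point of \<open>D j\<close> is sent back into \<open>U\<close>. This keeps the image
  of a block in \<open>D j\<close> off that block, which is the one position where the sizes of blocks give no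
  control.
\<close>

lemma strongly_rigid_refined: "strongly_rigid refined"
  unfolding strongly_rigid_def
proof (intro allI impI, rule ccontr)
  fix f assume f: "continuous_map refined refined f" and "\<not> (\<forall>x\<in>topspace refined. f x = x)"
    and nc: "\<not> (\<exists>c\<in>topspace refined. \<forall>x\<in>topspace refined. f x = c)"
  then obtain x where x: "x \<in> topspace T" "f x \<noteq> x" by (auto simp: topspace_refined)
  have fT: "f z \<in> topspace T" if "z \<in> topspace T" for z
    using that f continuous_map_image_subset_topspace unfolding topspace_refined by (metis image_subset_iff topspace_refined)
  have nonconst: "\<nexists>c. \<forall>x\<in>topspace refined. f x = c"
    using nc x(1) fT topspace_refined by metis
  note infinite_image = brown_space_infinite_image[OF brown_refined hausdorff_refined f nonconst]
  have pre: "openin refined {z \<in> topspace T. f z \<in> W}" if "openin refined W" for W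
    using openin_continuous_map_preimage[OF f that] by (simp add: topspace_refined)
  obtain U W where UW: "openin T U" "openin T W" "x \<in> U" "f x \<in> W" "disjnt U W"
    using hausdorff x fT unfolding Hausdorff_space_def by metis
  obtain U0 B0 where U0: "openin T U0" "small B0" "x \<in> U0 - B0"
    "U0 - B0 \<subseteq> {z \<in> topspace T. f z \<in> W}"
    using openin_refinedE[OF pre[OF openin_refined_if_openin[OF UW(2)]], of x] x UW(4) by blast
  define D where "D j = U \<inter> U0 \<inter> (\<Inter>i\<in>{i. i \<le> j \<and> x \<in> V i}. V i)" for j
  have D_open: "openin T (D j)" for j
  proof (cases "{i. i \<le> j \<and> x \<in> V i} = {}")
    case True then show ?thesis using UW U0 unfolding D_def by (metis INT_empty inf_top_right openin_Int)
  next
    case False then show ?thesis unfolding D_def using UW U0 V_open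
      by (intro openin_Int openin_INT2) auto
  qed
  have step: "\<exists>l E. block l \<subseteq> D j \<and> j * cutoff l < card {z \<in> block l. f z \<in> E} \<and>
      E \<subseteq> f ` block l \<inter> {cutoff (Suc j)..} - {f x} \<and> (E \<subseteq> {cutoff l..} - block l \<or> (\<exists>v. E = {v}))" for j
  proof -
    \<comment> \<open>Some point near \<open>x\<close> has its value outside the finite set to be avoided, because \<open>f\<close>
      takes infinitely many values there; by continuity so do all points of a basic open set
      \<open>U1 - B1\<close>.\<close>
    have "x \<in> D j - B0" using UW U0 unfolding D_def by blast
    then have "infinite (f ` (D j - B0))"
      using infinite_image openin_refined_diff[OF D_open U0(2)] by blast
    then obtain y where "y \<in> f ` (D j - B0)" "y \<notin> insert (f x) {..<cutoff (Suc j)}"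
      by (metis finite_insert finite_lessThan finite_subset subsetI)
    then obtain z where z: "z \<in> D j - B0" "f z \<notin> insert (f x) {..<cutoff (Suc j)}" by blast
    have "openin refined (topspace T - insert (f x) {..<cutoff (Suc j)})"
      by (intro openin_refined_diff small_finite) auto
    then have "openin refined ((D j - B0) \<inter> {z \<in> topspace T. f z \<in> topspace T - insert (f x) {..<cutoff (Suc j)}})"
      using openin_Int[OF openin_refined_diff[OF D_open U0(2)] pre] by blast
    moreover have "z \<in> topspace T" using z D_open openin_subset by blast
    then have "z \<in> (D j - B0) \<inter> {z \<in> topspace T. f z \<in> topspace T - insert (f x) {..<cutoff (Suc j)}}"
      using z fT by blast
    ultimately obtain U1 B1 where U1: "openin T U1" "small B1" "z \<in> U1 - B1"
      "U1 - B1 \<subseteq> (D j - B0) \<inter> {z \<in> topspace T. f z \<in> topspace T - insert (f x) {..<cutoff (Suc j)}}"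
      by (rule openin_refinedE)
    obtain C where C: "\<And>l. card (B1 \<inter> block l) \<le> C * cutoff l" using U1(2) unfolding small_def by blast
    have "openin T (U1 \<inter> D j)" "z \<in> U1 \<inter> D j" using U1 D_open z by auto
    then obtain m where m: "V m \<subseteq> U1 \<inter> D j" using V_base by blast
    \<comment> \<open>The index pays for \<open>C\<close>, the loss caused by \<open>B1\<close>, and for \<open>j\<close>, the excess demanded of
      the fibre.\<close>
    obtain l where l: "l \<ge> C + j" "block l \<subseteq> V m" using block_in_V by blast
    define Q where "Q = block l - B1"
    have QP: "Q \<subseteq> block l" unfolding Q_def by blast
    have Q: "Q \<subseteq> (D j - B0) \<inter> {z \<in> topspace T. f z \<in> topspace T - insert (f x) {..<cutoff (Suc j)}}"
      using U1(4) l(2) m unfolding Q_def by fast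
    have "f ` Q \<subseteq> W" using Q U0(4) unfolding D_def by blast
    moreover have "block l \<subseteq> U" using l(2) m unfolding D_def by blast
    ultimately have fQ: "f ` Q \<inter> block l = {}" using UW(5) by (auto simp: disjnt_iff)
    have "card (block l) \<le> card Q + card (B1 \<inter> block l)"
      using card_Un_le[of Q "B1 \<inter> block l"] unfolding Q_def
      by (metis Int_commute Un_Diff_Int)
    moreover have "C * cutoff l + j * cutoff l + j * (cutoff l * cutoff l) \<le> 2 * l * (cutoff l * cutoff l)"
    proof -
      have "C * cutoff l + j * cutoff l = (C + j) * cutoff l" by (simp add: add_mult_distrib)
      also have "\<dots> \<le> l * (cutoff l * cutoff l)" using l(1) cutoff_pos[of l] by (intro mult_le_mono) auto
      finally have "C * cutoff l + j * cutoff l \<le> l * (cutoff l * cutoff l)" .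
      moreover have "j * (cutoff l * cutoff l) \<le> l * (cutoff l * cutoff l)" using l(1) by (intro mult_le_mono) auto
      ultimately show ?thesis by linarith
    qed
    ultimately have "j * cutoff l + cutoff l * (j * cutoff l) < card Q"
      using C[of l] block_card[of l] by (simp add: algebra_simps)
    from value_set_with_large_preimage[OF QP fQ this] obtain E where E: "E \<subseteq> f ` Q"
      "j * cutoff l < card {z \<in> Q. f z \<in> E}" "E \<subseteq> {cutoff l..} - block l \<or> (\<exists>v. E = {v})" by blast
    have "card {z \<in> Q. f z \<in> E} \<le> card {z \<in> block l. f z \<in> E}"
      using QP block_finite by (intro card_mono) auto
    moreover have "f ` Q \<subseteq> f ` block l \<inter> {cutoff (Suc j)..} - {f x}" using Q QP by fastforce
    moreover have "block l \<subseteq> D j" using l m by blast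
    ultimately show ?thesis using E by (intro exI[of _ l] exI[of _ E]) auto
  qed
  then have "\<forall>j. \<exists>l E. block l \<subseteq> D j \<and> j * cutoff l < card {z \<in> block l. f z \<in> E} \<and>
      E \<subseteq> f ` block l \<inter> {cutoff (Suc j)..} - {f x} \<and>
      (E \<subseteq> {cutoff l..} - block l \<or> (\<exists>v. E = {v}))" by blast
  then obtain L E where L: "\<And>j. block (L j) \<subseteq> D j"
    and fibre: "\<And>j. j * cutoff (L j) < card {z \<in> block (L j). f z \<in> E j}"
    and E_sub: "\<And>j. E j \<subseteq> f ` block (L j) \<inter> {cutoff (Suc j)..} - {f x}"
    and E_alt: "\<And>j. E j \<subseteq> {cutoff (L j)..} - block (L j) \<or> (\<exists>v. E j = {v})"
    unfolding choice_iff by blast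
  \<comment> \<open>The values beyond their block and the single values are shown to be small separately.\<close>
  define J where "J = {j. \<exists>v. E j = {v}}"
  have "small (\<Union>j\<in>-J. E j)"
  proof (rule small_if_card_le)
    fix i
    have "(\<Union>j\<in>-J. E j) \<inter> block i \<subseteq> f ` {..<cutoff i}"
    proof
      fix e assume "e \<in> (\<Union>j\<in>-J. E j) \<inter> block i"
      then obtain j where j: "j \<notin> J" "e \<in> E j" "e \<in> block i" by blast
      then have e: "cutoff (L j) \<le> e" "e \<notin> block (L j)" using E_alt[of j] unfolding J_def by auto
      \<comment> \<open>The value lies beyond the start of the block it comes from but outside it, so it can
        only lie in a later block.\<close>
      have "cutoff (L j) < cutoff (Suc i)" using e(1) block_bounds(2)[OF j(3)] by simp
      then have "L j < Suc i" using cutoff_strict_mono strict_mono_less by blast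
      moreover have "L j \<noteq> i" using e(2) j(3) by blast
      ultimately have "Suc (L j) \<le> i" by simp
      moreover obtain z where "z \<in> block (L j)" "e = f z" using E_sub j(2) by blast
      ultimately show "e \<in> f ` {..<cutoff i}" using block_bounds(2) cutoff_mono by (meson image_eqI lessThan_iff less_le_trans)
    qed
    then have "card ((\<Union>j\<in>-J. E j) \<inter> block i) \<le> card (f ` {..<cutoff i})" by (simp add: card_mono)
    also have "\<dots> \<le> cutoff i" using card_image_le[of "{..<cutoff i}" f] by simp
    finally show "card ((\<Union>j\<in>-J. E j) \<inter> block i) \<le> 1 * cutoff i" by simp
  qed
  moreover have "small (\<Union>j\<in>J. E j)"
  proof (rule small_escaping)
    \<comment> \<open>The value at indices outside \<open>J\<close> is a dummy that satisfies the growth condition.\<close>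
    show "cutoff (Suc j) \<le> (if j \<in> J then the_elem (E j) else cutoff (Suc j))" for j
      using E_sub[of j] unfolding J_def by auto
    show "(\<Union>j\<in>J. E j) \<subseteq> range (\<lambda>j. if j \<in> J then the_elem (E j) else cutoff (Suc j))"
    proof
      fix v assume "v \<in> (\<Union>j\<in>J. E j)"
      then obtain j where j: "j \<in> J" "v \<in> E j" by blast
      then have "v = the_elem (E j)" unfolding J_def by auto
      then show "v \<in> range (\<lambda>j. if j \<in> J then the_elem (E j) else cutoff (Suc j))"
        using j(1) by (intro image_eqI[of _ _ j]) simp_all
    qed
  qed
  ultimately have "small ((\<Union>j\<in>-J. E j) \<union> (\<Union>j\<in>J. E j))" by (rule small_Un)
  moreover have "(\<Union>j\<in>-J. E j) \<union> (\<Union>j\<in>J. E j) = (\<Union>j. E j)" by blast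
  ultimately have E_small: "small (\<Union>j. E j)" by simp
  have "openin refined {z \<in> topspace T. f z \<in> topspace T - (\<Union>j. E j)}"
    using pre openin_refined_diff[OF openin_topspace E_small] by blast
  moreover have "x \<in> {z \<in> topspace T. f z \<in> topspace T - (\<Union>j. E j)}" using fT x E_sub by blast
  ultimately obtain G B where G: "openin T G" "small B" "x \<in> G - B"
    "G - B \<subseteq> {z \<in> topspace T. f z \<in> topspace T - (\<Union>j. E j)}"
    by (rule openin_refinedE)
  obtain C where C: "\<And>l. card (B \<inter> block l) \<le> C * cutoff l" using G(2) unfolding small_def by blast
  obtain m where m: "x \<in> V m" "V m \<subseteq> G" using V_base G by blast
  \<comment> \<open>Beyond the index \<open>m\<close> the sets \<open>D j\<close> lie in \<open>G\<close>, and beyond \<open>C\<close> the preimage of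
    \<open>E j\<close> is too large to be hidden in \<open>B\<close>.\<close>
  define j where "j = max m C"
  have "D j \<subseteq> V m" using m(1) unfolding D_def j_def by fastforce
  then have "block (L j) \<subseteq> G" using L[of j] m(2) by blast
  then have "{z \<in> block (L j). f z \<in> E j} \<subseteq> B \<inter> block (L j)" using G(4) by blast
  then have "card {z \<in> block (L j). f z \<in> E j} \<le> card (B \<inter> block (L j))"
    by (simp add: block_finite card_mono)
  also have "\<dots> \<le> C * cutoff (L j)" by (rule C)
  also have "\<dots> \<le> j * cutoff (L j)" unfolding j_def by simp
  finally show False using fibre[of j] by simp
qed

end


lemma strongly_rigid_refinement:
  fixes T :: "nat topology"
  assumes "Hausdorff_space T" "second_countable T" "brown_space T" "infinite (topspace T)"
  shows "\<exists>T'. topspace T' = topspace T \<and> (\<forall>U. openin T U \<longrightarrow> openin T' U) \<and>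
    Hausdorff_space T' \<and> brown_space T' \<and> strongly_rigid T' \<and> anticompact T'"
proof -
  obtain \<B> where \<B>: "countable \<B>" "\<And>U. U \<in> \<B> \<Longrightarrow> openin T U"
    "\<And>U x. openin T U \<Longrightarrow> x \<in> U \<Longrightarrow> \<exists>V\<in>\<B>. x \<in> V \<and> V \<subseteq> U"
    using assms(2) unfolding second_countable_def by metis
  define V where "V = from_nat_into (\<B> - {{}})"
  have "topspace T \<noteq> {}" using assms(4) by auto
  then have "\<B> - {{}} \<noteq> {}" using \<B>(3)[OF openin_topspace] by blast
  then have V: "range V = \<B> - {{}}"
    unfolding V_def using \<B>(1) by (simp add: range_from_nat_into)
  have "brown_base T V"
  proof
    show "openin T (V m)" "V m \<noteq> {}" for m using V \<B>(2) by blast+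
    show "\<exists>m. x \<in> V m \<and> V m \<subseteq> U" if Ux: "openin T U" "x \<in> U" for U x
    proof -
      obtain W where W: "W \<in> \<B>" "x \<in> W" "W \<subseteq> U" using \<B>(3)[OF Ux] by blast
      then have "W \<in> range V" using V by blast
      then show ?thesis using W by blast
    qed
  qed (use assms in auto)
  then interpret brown_base T V .
  show ?thesis
    using topspace_refined openin_refined_if_openin hausdorff_refined brown_refined
      strongly_rigid_refined anticompact_refined by blast
qed

section \<open>The Golomb topology\<close>

definition progression :: "nat \<Rightarrow> nat \<Rightarrow> nat set" where
  "progression a b = {z. 0 < z \<and> [z = a] (mod b)}"

definition golomb :: "nat topology" where
  "golomb = topology (\<lambda>W. W \<subseteq> {0<..} \<and>
     (\<forall>x\<in>W. \<exists>b>0. coprime x b \<and> progression x b \<subseteq> W))"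

lemma openin_golomb:
  "openin golomb W \<longleftrightarrow> W \<subseteq> {0<..} \<and> (\<forall>x\<in>W. \<exists>b>0. coprime x b \<and> progression x b \<subseteq> W)"
proof -
  have "istopology (\<lambda>W. W \<subseteq> {0<..} \<and>
     (\<forall>x\<in>W. \<exists>b>0. coprime x b \<and> progression x b \<subseteq> W))" (is "istopology ?L")
    unfolding istopology_def
  proof (intro conjI allI impI)
    fix S S' assume S: "?L S" and S': "?L S'"
    show "S \<inter> S' \<subseteq> {0<..}" using S by blast
    show "\<forall>x\<in>S \<inter> S'. \<exists>b>0. coprime x b \<and> progression x b \<subseteq> S \<inter> S'"
    proof
      fix x assume x: "x \<in> S \<inter> S'"
      obtain b where b: "0 < b" "coprime x b" "progression x b \<subseteq> S" using S x by blast
      obtain b' where b': "0 < b'" "coprime x b'" "progression x b' \<subseteq> S'" using S' x by blast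
      have "progression x (b * b') \<subseteq> progression x b \<inter> progression x b'"
        unfolding progression_def
        by (auto intro: cong_dvd_modulus_nat)
      then show "\<exists>b>0. coprime x b \<and> progression x b \<subseteq> S \<inter> S'"
        using b b' by (intro exI[of _ "b * b'"]) auto
    qed
  next
    fix \<K> assume K: "\<forall>K\<in>\<K>. ?L K"
    then show "\<Union>\<K> \<subseteq> {0<..}" by blast
    show "\<forall>x\<in>\<Union>\<K>. \<exists>b>0. coprime x b \<and> progression x b \<subseteq> \<Union>\<K>"
      using K by (meson Union_iff Union_upper subset_trans)
  qed
  then show ?thesis unfolding golomb_def by (simp add: topology_inverse')
qed

lemma openin_golomb_progression:
  assumes "0 < b" "coprime a b"
  shows "openin golomb (progression a b)"
  unfolding openin_golomb
proof (intro conjI ballI)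
  fix x assume x: "x \<in> progression a b"
  then have "[x = a] (mod b)" by (simp add: progression_def)
  then have "coprime x b" "progression x b = progression a b"
    using assms(2) unfolding progression_def
    by (meson cong_imp_coprime cong_sym, auto intro: cong_trans cong_sym)
  then show "\<exists>c>0. coprime x c \<and> progression x c \<subseteq> progression a b" using assms(1) by blast
qed (auto simp: progression_def)

lemma self_in_progression: "0 < x \<Longrightarrow> x \<in> progression x b"
  by (simp add: progression_def)

lemma topspace_golomb: "topspace golomb = {0<..}"
proof
  show "topspace golomb \<subseteq> {0<..}" using openin_topspace openin_golomb by blast
  have "openin golomb {0<..}"
    unfolding openin_golomb by (auto simp: progression_def intro!: exI[of _ 1])
  then show "{0<..} \<subseteq> topspace golomb" by (rule openin_subset)
qed

text \<open>
  For a prime \<open>p\<close> larger than two given points, the residue classes of these points modulo \<open>p\<close> are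
  disjoint, and the points are coprime to \<open>p\<close>.
\<close>

lemma hausdorff_golomb: "Hausdorff_space golomb"
  unfolding Hausdorff_space_def topspace_golomb
proof (intro allI impI)
  fix x y :: nat assume xy: "x \<in> {0<..} \<and> y \<in> {0<..} \<and> x \<noteq> y"
  obtain p where p: "prime p" "x + y < p" using bigger_prime by blast
  have "coprime z p" if "0 < z" "z < p" for z
    using prime_imp_coprime[OF p(1)] nat_dvd_not_less[OF that] coprime_commute by blast
  then have "coprime x p" "coprime y p" using p(2) xy by simp_all
  moreover have "disjnt (progression x p) (progression y p)"
  proof -
    have "\<not> [x = y] (mod p)" using p xy by (simp add: cong_def)
    then show ?thesis
      unfolding disjnt_iff progression_def by (auto dest: cong_trans cong_sym)
  qed
  moreover have "0 < p" using p(2) by simp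
  ultimately show "\<exists>U V. openin golomb U \<and> openin golomb V \<and> x \<in> U \<and> y \<in> V \<and> disjnt U V"
    using openin_golomb_progression self_in_progression xy by (meson greaterThan_iff)
qed

lemma second_countable_golomb: "second_countable golomb"
  unfolding second_countable_def
proof (intro exI conjI)
  let ?\<B> = "(\<lambda>(a, b). progression a b) ` {(a, b). 0 < b \<and> coprime a b}"
  show "countable ?\<B>" by (rule countable_image) simp
  show "\<forall>V\<in>?\<B>. openin golomb V" using openin_golomb_progression by auto
  show "\<forall>U x. openin golomb U \<and> x \<in> U \<longrightarrow> (\<exists>V\<in>?\<B>. x \<in> V \<and> V \<subseteq> U)"
  proof (intro allI impI)
    fix U x assume U: "openin golomb U \<and> x \<in> U"
    then obtain b where "0 < b" "coprime x b" "progression x b \<subseteq> U" "0 < x"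
      unfolding openin_golomb by blast
    then show "\<exists>V\<in>?\<B>. x \<in> V \<and> V \<subseteq> U"
      using self_in_progression by (intro bexI[of _ "progression x b"]) auto
  qed
qed

text \<open>
  A basic neighbourhood of \<open>w\<close> has a modulus coprime to \<open>w\<close>, hence to its divisor \<open>b\<close>, and the
  Chinese remainder theorem applies.
\<close>

lemma multiple_in_closure:
  assumes b: "b dvd w" "0 < w"
  shows "w \<in> golomb closure_of (progression a b)"
  unfolding in_closure_of topspace_golomb
proof (intro conjI allI impI)
  show "w \<in> {0<..}" using b by simp
  fix W assume W: "w \<in> W \<and> openin golomb W"
  then obtain c where c: "0 < c" "coprime w c" "progression w c \<subseteq> W"
    unfolding openin_golomb by blast
  have "coprime b c" using coprime_divisors[OF b(1) dvd_refl c(2)] .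
  then obtain z where z: "[z = a] (mod b)" "[z = w] (mod c)"
    using binary_chinese_remainder_nat by blast
  have "0 < b" using b by (auto intro: Nat.gr0I)
  then have "z + b * c \<in> progression a b" "z + b * c \<in> progression w c"
    using z c(1) by (simp_all add: progression_def cong_def)
  then show "\<exists>y. y \<in> progression a b \<and> y \<in> W" using c(3) by blast
qed

text \<open>
  The product of the moduli of two progressions is in the closure of both.
\<close>

lemma brown_golomb: "brown_space golomb"
  unfolding brown_space_def
proof (intro allI impI)
  fix U W assume U: "openin golomb U" "U \<noteq> {}" and W: "openin golomb W" "W \<noteq> {}"
  obtain x b where b: "0 < b" "progression x b \<subseteq> U" using U unfolding openin_golomb by blast
  obtain y c where c: "0 < c" "progression y c \<subseteq> W" using W unfolding openin_golomb by blast
  have "b * c \<in> golomb closure_of (progression x b) \<inter> golomb closure_of (progression y c)"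
    using b(1) c(1) by (simp add: multiple_in_closure)
  then show "golomb closure_of U \<inter> golomb closure_of W \<noteq> {}"
    using closure_of_mono[OF b(2)] closure_of_mono[OF c(2)] by blast
qed

theorem corollary1p4:
  "\<exists>X :: nat topology. countable (topspace X) \<and> infinite (topspace X) \<and>
     Hausdorff_space X \<and> strongly_rigid X \<and> anticompact X"
proof -
  have "infinite (topspace golomb)" by (simp add: topspace_golomb infinite_Ioi)
  from strongly_rigid_refinement[OF hausdorff_golomb second_countable_golomb brown_golomb this]
  obtain X :: "nat topology" where "topspace X = topspace golomb" "Hausdorff_space X"
    "strongly_rigid X" "anticompact X" by blast
  then show ?thesis
    using \<open>infinite (topspace golomb)\<close> by (intro exI[of _ X]) simp
qed

end
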